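(* Let $A$ be a commutative associative algebra over a field $\mathbf{k}$, let $D_1,\ldots,D_n$ be finitely many derivations of $A$, and let $\mathfrak{g}$ be the Lie subalgebra of $\mathrm{Der}(A)$ generated by $D_1,\ldots,D_n$. Suppose that $\mathfrak{g}$ is finite-dimensional. Then every derived operation $\{-,-\}$ on $A$ defined using $D_1,\ldots,D_n$ satisfies a standard identity: there exists $d>0$ such that $$s_{d,l}^{\{-,-\}}(a_1,\ldots,a_d)=s_{d,r}^{\{-,-\}}(a_1,\ldots,a_d)=0$$ for all $a_1,\ldots,a_d\in A$. In fact, if $\dim\mathfrak{g}\ge 1$, one can take $d=1+\binom{\dim\mathfrak{g}+p}{\dim\mathfrak{g}}$ for any integer $p> m\left(1+\frac{1}{\dim\mathfrak{g}}\right)$, where $m$ is the $\mathfrak{g}$-order of $\{-,-\}$.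
   Context: The universal enveloping algebra $U(\mathfrak{g})$ acts on $A$ by linear operators (a product of elements of $\mathfrak g$ acts as the composition of the corresponding derivations, and $1$ acts as the identity). Derived operation: a bilinear operation on $A$ of the form $$\{a,b\}:=\sum_{j=1}^s f_j(a)\, g_j(b),$$ where $f_1,g_1,\ldots,f_s,g_s$ are linear combinations of iterations of the derivations $D_1,\ldots,D_n$ (the empty iteration, i.e. the identity map, is allowed), regarded as given elements of $U(\mathfrak g)$. $\mathfrak{g}$-order: let $F^\bullet U(\mathfrak{g})$ be the standard filtration of $U(\mathfrak g)$, determined by $F^0U(\mathfrak{g})=\mathbf{k}1$, $F^1U(\mathfrak{g})=\mathbf{k}1\oplus\mathfrak{g}$, $F^kU(\mathfrak{g})\,F^lU(\mathfrak{g})\subset F^{k+l}U(\mathfrak{g})$; that is, $F^kU(\mathfrak g)$ is the span of all products of at most $k$ elements of $\mathfrak{g}$. If the derived operation is given by the formula above with $f_j\in F^{n_j}U(\mathfrak{g})$ and $g_j\in F^{m_j}U(\mathfrak{g})$, its $\mathfrak{g}$-order is $\max_j(n_j+m_j)$. Standard polynomials: for a bilinear operation $\{-,-\}$ on $A$, $$s_{d,l}^{\{-,-\}}(a_1,\ldots,a_d):=\sum_{\sigma\in S_{d-1}}(-1)^{\sigma}\{a_{\sigma(1)},\{a_{\sigma(2)},\{\ldots,\{a_{\sigma(d-2)},\{a_{\sigma(d-1)},a_d\}\}\ldots\}\}\},$$ $$s_{d,r}^{\{-,-\}}(a_1,\ldots,a_d):=\sum_{\sigma\in S_{d-1}}(-1)^{\sigma}\{\{\{\ldots\{\{a_d,a_{\sigma(d-1)}\},a_{\sigma(d-2)}\},\ldots\},a_{\sigma(2)}\},a_{\sigma(1)}\},$$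 where $(-1)^\sigma$ is the sign of the permutation $\sigma$. *)

theory Defs
  imports
    Complex_Main
    "HOL-Library.Poly_Mapping"
    "HOL-Library.Function_Algebras"
    "HOL-Combinatorics.Permutations"
begin

section \<open>Commutative algebras and Lie algebras of derivations\<close>

text \<open>The class \<^class>\<open>comm_ring\<close> does not include a unit, so algebras are not assumed unital.\<close>

locale comm_algebra = vector_space scale
  for scale :: "'k::field \<Rightarrow> 'a::comm_ring \<Rightarrow> 'a" +
  assumes scale_mult_left: "scale c (x * y) = scale c x * y"

definition fun_scale :: "('k \<Rightarrow> 'a \<Rightarrow> 'a) \<Rightarrow> 'k \<Rightarrow> ('a \<Rightarrow> 'a) \<Rightarrow> ('a \<Rightarrow> 'a)" where
  "fun_scale scale c f = (\<lambda>x. scale c (f x))"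

definition commutator :: "('a \<Rightarrow> 'a) \<Rightarrow> ('a \<Rightarrow> 'a) \<Rightarrow> ('a \<Rightarrow> 'a::ab_group_add)" where
  "commutator f g = (f \<circ> g) - (g \<circ> f)"

definition derivations :: "('k::field \<Rightarrow> 'a::comm_ring \<Rightarrow> 'a) \<Rightarrow> ('a \<Rightarrow> 'a) set" where
  "derivations scale =
    {D. Vector_Spaces.linear scale scale D \<and> (\<forall>a b. D (a * b) = D a * b + a * D b)}"

definition lie_subalgebra_of_Der :: "('k::field \<Rightarrow> 'a::comm_ring \<Rightarrow> 'a) \<Rightarrow> ('a \<Rightarrow> 'a) set \<Rightarrow> bool" where
  "lie_subalgebra_of_Der scale L \<longleftrightarrow>
    L \<subseteq> derivations scale \<and> module.subspace (fun_scale scale) L \<and>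
    (\<forall>f\<in>L. \<forall>g\<in>L. commutator f g \<in> L)"

definition lie_generated :: "('k::field \<Rightarrow> 'a::comm_ring \<Rightarrow> 'a) \<Rightarrow> ('a \<Rightarrow> 'a) set \<Rightarrow> ('a \<Rightarrow> 'a) set" where
  "lie_generated scale S = lie_subalgebra_of_Der scale hull S"

definition finite_dimensional :: "('k::field \<Rightarrow> 'v::ab_group_add \<Rightarrow> 'v) \<Rightarrow> 'v set \<Rightarrow> bool" where
  "finite_dimensional sc V \<longleftrightarrow> (\<exists>B. finite B \<and> module.span sc B = V)"


section \<open>The universal enveloping algebra\<close>

text \<open>Words form the free monoid, written additively so that \<open>'x fword \<Rightarrow>\<^sub>0 'k\<close> carries the
  multiplication of the free associative unital algebra on \<open>'x\<close>.\<close>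

datatype 'x fword = FWord (letters: "'x list")

instantiation fword :: (type) monoid_add
begin

definition zero_fword :: "'a fword" where
  "zero_fword = FWord []"

definition plus_fword :: "'a fword \<Rightarrow> 'a fword \<Rightarrow> 'a fword" where
  "plus_fword u v = FWord (letters u @ letters v)"

instance
  by standard (simp_all add: zero_fword_def plus_fword_def)

end

definition free_algebra :: "'x set \<Rightarrow> ('x fword \<Rightarrow>\<^sub>0 'k::field) set" where
  "free_algebra X = {P. \<forall>w\<in>Poly_Mapping.keys P. set (letters w) \<subseteq> X}"

definition gen :: "'x \<Rightarrow> ('x fword \<Rightarrow>\<^sub>0 'k::field)" where
  "gen x = Poly_Mapping.single (FWord [x]) 1"

text \<open>The enveloping algebra of a Lie algebra \<open>L\<close> with scalar multiplication \<open>sc\<close> and bracket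
  \<open>br\<close> is the quotient of the tensor algebra of \<open>L\<close> by the relations \<open>xy - yx = [x,y]\<close>. The tensor
  algebra is in turn the quotient of the free algebra on the set \<open>L\<close> by the relations that make the
  inclusion of \<open>L\<close> linear; both kinds of relations are imposed at once.\<close>

definition env_relators ::
  "('k::field \<Rightarrow> 'l::ab_group_add \<Rightarrow> 'l) \<Rightarrow> ('l \<Rightarrow> 'l \<Rightarrow> 'l) \<Rightarrow> 'l set \<Rightarrow> ('l fword \<Rightarrow>\<^sub>0 'k) set" where
  "env_relators sc br L =
    {gen (x + y) - gen x - gen y | x y. x \<in> L \<and> y \<in> L} \<union>
    {gen (sc c x) - Poly_Mapping.single 0 c * gen x | c x. x \<in> L} \<union>
    {gen x * gen y - gen y * gen x - gen (br x y) | x y. x \<in> L \<and> y \<in> L}"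

inductive_set env_ideal ::
  "('k::field \<Rightarrow> 'l::ab_group_add \<Rightarrow> 'l) \<Rightarrow> ('l \<Rightarrow> 'l \<Rightarrow> 'l) \<Rightarrow> 'l set \<Rightarrow> ('l fword \<Rightarrow>\<^sub>0 'k) set"
  for sc br L where
  zero: "0 \<in> env_ideal sc br L"
| relator: "R \<in> env_relators sc br L \<Longrightarrow> R \<in> env_ideal sc br L"
| add: "P \<in> env_ideal sc br L \<Longrightarrow> Q \<in> env_ideal sc br L \<Longrightarrow> P + Q \<in> env_ideal sc br L"
| mult_left: "P \<in> env_ideal sc br L \<Longrightarrow> Q \<in> free_algebra L \<Longrightarrow> Q * P \<in> env_ideal sc br L"
| mult_right: "P \<in> env_ideal sc br L \<Longrightarrow> Q \<in> free_algebra L \<Longrightarrow> P * Q \<in> env_ideal sc br L"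

definition env_class ::
  "('k::field \<Rightarrow> 'l::ab_group_add \<Rightarrow> 'l) \<Rightarrow> ('l \<Rightarrow> 'l \<Rightarrow> 'l) \<Rightarrow> 'l set \<Rightarrow>
    ('l fword \<Rightarrow>\<^sub>0 'k) \<Rightarrow> ('l fword \<Rightarrow>\<^sub>0 'k) set" where
  "env_class sc br L P = (\<lambda>Q. P + Q) ` env_ideal sc br L"

definition env_algebra ::
  "('k::field \<Rightarrow> 'l::ab_group_add \<Rightarrow> 'l) \<Rightarrow> ('l \<Rightarrow> 'l \<Rightarrow> 'l) \<Rightarrow> 'l set \<Rightarrow> ('l fword \<Rightarrow>\<^sub>0 'k) set set" where
  "env_algebra sc br L = env_class sc br L ` free_algebra L"

definition env_filtration ::
  "('k::field \<Rightarrow> 'l::ab_group_add \<Rightarrow> 'l) \<Rightarrow> ('l \<Rightarrow> 'l \<Rightarrow> 'l) \<Rightarrow> 'l set \<Rightarrow> nat \<Rightarrow>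
    ('l fword \<Rightarrow>\<^sub>0 'k) set set" where
  "env_filtration sc br L k =
    env_class sc br L ` {P \<in> free_algebra L. \<forall>w\<in>Poly_Mapping.keys P. length (letters w) \<le> k}"

text \<open>The elements of the enveloping algebra of \<open>L\<close> that are linear combinations of products of
  elements of \<open>X \<subseteq> L\<close>.\<close>

definition env_combinations ::
  "('k::field \<Rightarrow> 'l::ab_group_add \<Rightarrow> 'l) \<Rightarrow> ('l \<Rightarrow> 'l \<Rightarrow> 'l) \<Rightarrow> 'l set \<Rightarrow> 'l set \<Rightarrow>
    ('l fword \<Rightarrow>\<^sub>0 'k) set set" where
  "env_combinations sc br L X = env_class sc br L ` free_algebra X"


section \<open>The action of the enveloping algebra of a Lie algebra of operators\<close>

definition word_act :: "('a \<Rightarrow> 'a) fword \<Rightarrow> 'a \<Rightarrow> 'a" where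
  "word_act w = foldr (\<circ>) (letters w) id"

definition free_act ::
  "('k::field \<Rightarrow> 'a::ab_group_add \<Rightarrow> 'a) \<Rightarrow> (('a \<Rightarrow> 'a) fword \<Rightarrow>\<^sub>0 'k) \<Rightarrow> 'a \<Rightarrow> 'a" where
  "free_act scale P a = (\<Sum>w\<in>Poly_Mapping.keys P. scale (Poly_Mapping.lookup P w) (word_act w a))"

text \<open>The choice of the representative is immaterial: see \<open>env_act_class\<close> below.\<close>

definition env_act ::
  "('k::field \<Rightarrow> 'a::ab_group_add \<Rightarrow> 'a) \<Rightarrow> (('a \<Rightarrow> 'a) fword \<Rightarrow>\<^sub>0 'k) set \<Rightarrow> 'a \<Rightarrow> 'a" where
  "env_act scale u = free_act scale (SOME P. P \<in> u)"

context vector_space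
begin

lemma free_act_superset:
  assumes "finite W" "Poly_Mapping.keys P \<subseteq> W"
  shows "free_act scale P a = (\<Sum>w\<in>W. scale (Poly_Mapping.lookup P w) (word_act w a))"
  unfolding free_act_def
  by (rule sum.mono_neutral_left) (use assms in \<open>auto simp: in_keys_iff\<close>)

lemma free_act_add: "free_act scale (P + Q) a = free_act scale P a + free_act scale Q a"
proof -
  let ?W = "Poly_Mapping.keys P \<union> Poly_Mapping.keys Q"
  have "free_act scale (P + Q) a =
      (\<Sum>w\<in>?W. scale (Poly_Mapping.lookup (P + Q) w) (word_act w a))"
    by (rule free_act_superset) (simp_all add: Poly_Mapping.keys_add)
  also have "\<dots> = (\<Sum>w\<in>?W. scale (Poly_Mapping.lookup P w) (word_act w a)) +
      (\<Sum>w\<in>?W. scale (Poly_Mapping.lookup Q w) (word_act w a))"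
    by (simp add: lookup_add scale_left_distrib sum.distrib)
  also have "\<dots> = free_act scale P a + free_act scale Q a"
    by (simp add: free_act_superset[of ?W P] free_act_superset[of ?W Q])
  finally show ?thesis .
qed

lemma free_act_zero [simp]: "free_act scale 0 a = 0"
  by (simp add: free_act_def)

lemma free_act_diff: "free_act scale (P - Q) a = free_act scale P a - free_act scale Q a"
  using free_act_add[of "P - Q" Q a] by (simp add: algebra_simps)

lemma free_act_sum: "free_act scale (sum f I) a = (\<Sum>i\<in>I. free_act scale (f i) a)"
  by (induction I rule: infinite_finite_induct) (simp_all add: free_act_add)

lemma free_act_single: "free_act scale (Poly_Mapping.single w c) a = scale c (word_act w a)"
  by (cases "c = 0") (simp_all add: free_act_def)

lemma free_act_gen [simp]: "free_act scale (gen x) = x"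
  by (rule ext) (simp add: gen_def free_act_single word_act_def)

lemma word_act_plus:
  fixes u v :: "('c \<Rightarrow> 'c) fword"
  shows "word_act (u + v) = word_act u \<circ> word_act v"
proof -
  have "foldr (\<circ>) xs h = foldr (\<circ>) xs id \<circ> h" for xs :: "('c \<Rightarrow> 'c) list" and h
    by (induction xs) (auto simp: comp_assoc)
  from this[of "letters u" "foldr (\<circ>) (letters v) id"] show ?thesis
    by (simp add: word_act_def plus_fword_def)
qed

lemma word_act_linear:
  assumes "\<And>f. f \<in> L \<Longrightarrow> Vector_Spaces.linear scale scale f" "set (letters w) \<subseteq> L"
  shows "Vector_Spaces.linear scale scale (word_act w)"
proof -
  have "Vector_Spaces.linear scale scale (foldr (\<circ>) fs id)" if "set fs \<subseteq> L" for fs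
    using that
    by (induction fs) (auto intro: linear_id Vector_Spaces.linear_compose assms(1))
  then show ?thesis using assms(2) by (simp add: word_act_def)
qed

lemma free_act_mult:
  assumes lin: "\<And>f. f \<in> L \<Longrightarrow> Vector_Spaces.linear scale scale f" and P: "P \<in> free_algebra L"
  shows "free_act scale (P * Q) a = free_act scale P (free_act scale Q a)"
proof -
  have expand: "R = (\<Sum>w\<in>Poly_Mapping.keys R. Poly_Mapping.single w (Poly_Mapping.lookup R w))"
    for R :: "('b \<Rightarrow> 'b) fword \<Rightarrow>\<^sub>0 'a"
    by (rule poly_mapping_eqI) (auto simp: lookup_sum lookup_single when_def in_keys_iff)
  have "free_act scale (P * Q) a =
      (\<Sum>w\<in>Poly_Mapping.keys P. \<Sum>v\<in>Poly_Mapping.keys Q.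
        scale (Poly_Mapping.lookup P w * Poly_Mapping.lookup Q v) (word_act w (word_act v a)))"
    by (subst expand[of P], subst expand[of Q])
      (simp add: sum_product mult_single free_act_sum free_act_single word_act_plus)
  also have "\<dots> = (\<Sum>w\<in>Poly_Mapping.keys P.
      scale (Poly_Mapping.lookup P w) (word_act w (free_act scale Q a)))"
  proof (rule sum.cong[OF refl])
    fix w assume "w \<in> Poly_Mapping.keys P"
    then have "set (letters w) \<subseteq> L"
      using P by (auto simp: free_algebra_def)
    then interpret w: Vector_Spaces.linear scale scale "word_act w"
      using word_act_linear lin by blast
    show "(\<Sum>v\<in>Poly_Mapping.keys Q.
        scale (Poly_Mapping.lookup P w * Poly_Mapping.lookup Q v) (word_act w (word_act v a))) =
      scale (Poly_Mapping.lookup P w) (word_act w (free_act scale Q a))"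
      by (simp add: free_act_def w.sum w.scale scale_sum_right)
  qed
  also have "\<dots> = free_act scale P (free_act scale Q a)"
    by (simp add: free_act_def)
  finally show ?thesis .
qed

lemma free_act_zero_right:
  assumes lin: "\<And>f. f \<in> L \<Longrightarrow> Vector_Spaces.linear scale scale f" and P: "P \<in> free_algebra L"
  shows "free_act scale P 0 = 0"
  using free_act_mult[OF lin P, of 0 0] by simp

lemma free_act_relator:
  assumes lin: "\<And>f. f \<in> L \<Longrightarrow> Vector_Spaces.linear scale scale f"
    and R: "R \<in> env_relators (fun_scale scale) commutator L"
  shows "free_act scale R a = 0"
proof -
  have gen: "gen x \<in> free_algebra L" if "x \<in> L" for x
    using that by (simp add: gen_def free_algebra_def)
  have const: "Poly_Mapping.single 0 c \<in> free_algebra L" for c :: 'a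
    by (simp add: free_algebra_def zero_fword_def)
  have word_zero: "word_act 0 = id"
    by (simp add: word_act_def zero_fword_def)
  show ?thesis
    using R unfolding env_relators_def
    by (auto simp: free_act_diff free_act_mult[OF lin gen] free_act_mult[OF lin const]
        free_act_single fun_scale_def commutator_def word_zero)
qed

lemma free_act_ideal:
  assumes lin: "\<And>f. f \<in> L \<Longrightarrow> Vector_Spaces.linear scale scale f"
    and closed: "\<And>x y. x \<in> L \<Longrightarrow> y \<in> L \<Longrightarrow> x + y \<in> L"
      "\<And>c x. x \<in> L \<Longrightarrow> fun_scale scale c x \<in> L"
      "\<And>x y. x \<in> L \<Longrightarrow> y \<in> L \<Longrightarrow> commutator x y \<in> L"
    and P: "P \<in> env_ideal (fun_scale scale) commutator L"
  shows "free_act scale P a = 0"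
proof -
  have gen: "gen x \<in> free_algebra L" if "x \<in> L" for x
    using that by (simp add: gen_def free_algebra_def)
  have const: "Poly_Mapping.single 0 c \<in> free_algebra L" for c :: 'a
    by (simp add: free_algebra_def zero_fword_def)
  have diff: "Q - R \<in> free_algebra L" if "Q \<in> free_algebra L" "R \<in> free_algebra L" for Q R
    using that keys_diff[of Q R] by (fastforce simp: free_algebra_def)
  have plus: "Q + R \<in> free_algebra L" if "Q \<in> free_algebra L" "R \<in> free_algebra L" for Q R
    using that Poly_Mapping.keys_add[of Q R] by (fastforce simp: free_algebra_def)
  have mult: "Q * R \<in> free_algebra L" if "Q \<in> free_algebra L" "R \<in> free_algebra L" for Q R
    using that keys_mult[of Q R] by (fastforce simp: free_algebra_def plus_fword_def)
  have "P \<in> free_algebra L \<and> (\<forall>a. free_act scale P a = 0)"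
    using P
  proof induction
    case zero
    then show ?case by (simp add: free_algebra_def)
  next
    case (relator R)
    then have "R \<in> free_algebra L"
      by (auto simp: env_relators_def intro!: diff mult gen const closed)
    with relator show ?case using free_act_relator[OF lin] by blast
  next
    case (add P Q)
    then show ?case
      by (simp add: free_act_add plus)
  next
    case (mult_left P Q)
    then show ?case
      by (auto simp: mult free_act_mult[OF lin] free_act_zero_right[OF lin])
  next
    case (mult_right P Q)
    then show ?case
      by (auto simp: mult free_act_mult[OF lin])
  qed
  then show ?thesis by blast
qed

end

lemma env_act_class:
  assumes "comm_algebra scale" and L: "lie_subalgebra_of_Der scale L"
  shows "env_act scale (env_class (fun_scale scale) commutator L P) = free_act scale P"
proof
  fix a
  interpret comm_algebra scale by fact
  interpret fs: vector_space "fun_scale scale"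
    by unfold_locales (auto simp: fun_scale_def algebra_simps)
  let ?u = "env_class (fun_scale scale) commutator L P"
  have "P \<in> ?u"
    by (auto simp: env_class_def intro!: image_eqI[of _ _ 0] env_ideal.zero)
  then have "(SOME Q. Q \<in> ?u) \<in> ?u" by (rule someI)
  then obtain Q where Q: "Q \<in> env_ideal (fun_scale scale) commutator L"
    and eq: "(SOME Q. Q \<in> ?u) = P + Q"
    by (auto simp: env_class_def)
  have "free_act scale Q a = 0"
    by (rule free_act_ideal[OF _ _ _ _ Q])
      (use L in \<open>auto simp: lie_subalgebra_of_Der_def derivations_def fs.subspace_def\<close>)
  then show "env_act scale ?u a = free_act scale P a"
    by (simp add: env_act_def eq free_act_add)
qed


section \<open>Derived operations and standard polynomials\<close>

definition derived_operation ::
  "('k::field \<Rightarrow> 'a::comm_ring \<Rightarrow> 'a) \<Rightarrow> nat \<Rightarrow> (nat \<Rightarrow> (('a \<Rightarrow> 'a) fword \<Rightarrow>\<^sub>0 'k) set) \<Rightarrow>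
    (nat \<Rightarrow> (('a \<Rightarrow> 'a) fword \<Rightarrow>\<^sub>0 'k) set) \<Rightarrow> 'a \<Rightarrow> 'a \<Rightarrow> 'a" where
  "derived_operation scale s f g a b = (\<Sum>j=1..s. env_act scale (f j) a * env_act scale (g j) b)"

text \<open>The order of a derived operation with respect to filtration degrees \<open>\<nu> j\<close> of \<open>f j\<close> and
  \<open>\<mu> j\<close> of \<open>g j\<close>; the inserted 0 only matters for the empty sum.\<close>

definition lie_order :: "nat \<Rightarrow> (nat \<Rightarrow> nat) \<Rightarrow> (nat \<Rightarrow> nat) \<Rightarrow> nat" where
  "lie_order s \<nu> \<mu> = Max (insert 0 ((\<lambda>j. \<nu> j + \<mu> j) ` {1..s}))"

text \<open>Both polynomials depend on \<open>a 1, \<dots>, a d\<close> only. Note that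
  \<open>foldr h [1..<d] z = h 1 (h 2 (\<dots> (h (d - 1) z)))\<close>.\<close>

definition standard_left ::
  "('k::field \<Rightarrow> 'a::comm_ring \<Rightarrow> 'a) \<Rightarrow> ('a \<Rightarrow> 'a \<Rightarrow> 'a) \<Rightarrow> nat \<Rightarrow> (nat \<Rightarrow> 'a) \<Rightarrow> 'a" where
  "standard_left scale br d a =
    (\<Sum>\<sigma> | \<sigma> permutes {1..<d}.
      scale (of_int (sign \<sigma>)) (foldr (\<lambda>i x. br (a (\<sigma> i)) x) [1..<d] (a d)))"

definition standard_right ::
  "('k::field \<Rightarrow> 'a::comm_ring \<Rightarrow> 'a) \<Rightarrow> ('a \<Rightarrow> 'a \<Rightarrow> 'a) \<Rightarrow> nat \<Rightarrow> (nat \<Rightarrow> 'a) \<Rightarrow> 'a" where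
  "standard_right scale br d a =
    (\<Sum>\<sigma> | \<sigma> permutes {1..<d}.
      scale (of_int (sign \<sigma>)) (foldr (\<lambda>i x. br x (a (\<sigma> i))) [1..<d] (a d)))"

definition standard_identity ::
  "('k::field \<Rightarrow> 'a::comm_ring \<Rightarrow> 'a) \<Rightarrow> ('a \<Rightarrow> 'a \<Rightarrow> 'a) \<Rightarrow> nat \<Rightarrow> bool" where
  "standard_identity scale br d \<longleftrightarrow>
    (\<forall>a. standard_left scale br d a = 0 \<and> standard_right scale br d a = 0)"

end

theory Submission
  imports Defs
begin

text \<open>
  Choose a spanning family \<open>e\<^sub>0, \<dots>, e\<^sub>N\<^sub>-\<^sub>1\<close> of \<open>\<gg>\<close>. Every operator of order at most \<open>k\<close> is a
  combination of ordered monomials of degree at most \<open>k\<close> in the \<open>e\<^sub>i\<close> (the easy half of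
  Poincare--Birkhoff--Witt). By the Leibniz rule, a \<open>(d - 1)\<close>-fold nested bracket is a combination of
  products \<open>M\<^sub>1(a\<^sub>1) \<cdots> M\<^sub>d(a\<^sub>d)\<close> of ordered monomials of total degree at most \<open>m (d - 1)\<close>.
  Alternating over \<open>a\<^sub>1, \<dots>, a\<^sub>d\<^sub>-\<^sub>1\<close> kills each product in which two of \<open>M\<^sub>1, \<dots>, M\<^sub>d\<^sub>-\<^sub>1\<close> coincide.
  If they are distinct and \<open>d - 1 = (N + p choose N)\<close>, the number of monomials of degree at most \<open>p\<close>,
  their total degree is at least that of all these monomials together, which is
  \<open>(d - 1) p N / (N + 1) > m (d - 1)\<close>. The right identity is the left one for the opposite operation.
\<close>

section \<open>Counting sorted words\<close>

text \<open>A sorted word is a multiset of indices, so it encodes one monomial of degree at most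
  \<open>k\<close> in \<open>N\<close> commuting variables.\<close>

definition sorted_words :: "nat \<Rightarrow> nat \<Rightarrow> nat list set" where
  "sorted_words N k = {w. sorted w \<and> set w \<subseteq> {..<N} \<and> length w \<le> k}"

text \<open>In a sorted word the largest letter \<open>N\<close> can only stand at the end.
  Splitting by whether it occurs is the combinatorial form of Pascal's rule.\<close>

lemma sorted_words_Suc_subset:
  "sorted_words (Suc N) (Suc k) \<subseteq>
    sorted_words N (Suc k) \<union> (\<lambda>w. w @ [N]) ` sorted_words (Suc N) k"
proof
  fix w assume w: "w \<in> sorted_words (Suc N) (Suc k)"
  show "w \<in> sorted_words N (Suc k) \<union> (\<lambda>w. w @ [N]) ` sorted_words (Suc N) k"
  proof (cases "N \<in> set w")
    case False
    then show ?thesis using w by (auto simp: sorted_words_def less_Suc_eq)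
  next
    case True
    then obtain v x where v: "w = v @ [x]" by (cases w rule: rev_cases) auto
    have "x = N" using True w v by (fastforce simp: sorted_words_def sorted_append)
    moreover have "v \<in> sorted_words (Suc N) k"
      using w v by (auto simp: sorted_words_def sorted_append)
    ultimately show ?thesis using v by blast
  qed
qed

text \<open>Induction on \<open>N + k\<close>: the preceding splitting reproduces the recursion of
  the binomial coefficients.\<close>

lemma card_sorted_words_le:
  "finite (sorted_words N k) \<and> card (sorted_words N k) \<le> (N + k) choose N"
proof (induction "N + k" arbitrary: N k rule: less_induct)
  case less
  consider "N = 0 \<or> k = 0" | N' k' where "N = Suc N'" "k = Suc k'"
    by (cases N; cases k) auto
  then show ?case
  proof cases
    case 1
    then have "sorted_words N k \<subseteq> {[]}" by (auto simp: sorted_words_def)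
    then have "finite (sorted_words N k)" "card (sorted_words N k) \<le> 1"
      using finite_subset[of _ "{[]}"] card_mono[of "{[]}"] by simp_all
    then show ?thesis using 1 by auto
  next
    case 2
    let ?A = "sorted_words N' (Suc k')" and ?B = "sorted_words (Suc N') k'"
    have A: "finite ?A" "card ?A \<le> (N' + Suc k') choose N'"
      using less[of N' "Suc k'"] 2 by auto
    have B: "finite ?B" "card ?B \<le> (Suc N' + k') choose Suc N'"
      using less[of "Suc N'" k'] 2 by auto
    let ?U = "?A \<union> (\<lambda>w. w @ [N']) ` ?B"
    have U: "finite ?U" using A B by simp
    have "card ?U \<le> card ?A + card ((\<lambda>w. w @ [N']) ` ?B)" by (rule card_Un_le)
    also have "\<dots> \<le> card ?A + card ?B" using card_image_le[OF B(1)] by simp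
    also have "\<dots> \<le> (N + k) choose N" using A B 2 by simp
    finally show ?thesis
      using sorted_words_Suc_subset[of N' k'] U 2
      by (meson card_mono finite_subset le_trans)
  qed
qed

text \<open>Double counting of pairs \<open>(w, k)\<close> with \<open>length w\<close> \<le>
  \<open>k < p\<close>: summing over \<open>k\<close> first, each layer consists of sorted words of
  length at most \<open>k\<close>, whose number is bounded by a binomial coefficient.\<close>

lemma sum_length_sorted_words_ge:
  assumes S: "finite S" "\<And>w. w \<in> S \<Longrightarrow> sorted w \<and> set w \<subseteq> {..<N}"
  shows "p * card S \<le> (\<Sum>w\<in>S. length w) + ((N + p) choose Suc N)"
proof -
  have layers: "p - l = (\<Sum>k<p. if l \<le> k then 1 else 0)" for l :: nat
    by (induction p) (auto simp: Suc_diff_le)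
  have "(\<Sum>w\<in>S. p - length w) = (\<Sum>k<p. card {w \<in> S. length w \<le> k})"
    by (subst layers, subst sum.swap) (simp add: S(1) sum.If_cases Int_def)
  also have "\<dots> \<le> (\<Sum>k<p. (N + k) choose N)"
  proof (rule sum_mono)
    fix k
    have "{w \<in> S. length w \<le> k} \<subseteq> sorted_words N k"
      using S by (auto simp: sorted_words_def)
    then show "card {w \<in> S. length w \<le> k} \<le> (N + k) choose N"
      using card_sorted_words_le[of N k] by (meson card_mono le_trans)
  qed
  \<comment> \<open>Hockey-stick identity.\<close>
  also have "\<dots> = (N + p) choose Suc N"
    by (induction p) auto
  finally have "(\<Sum>w\<in>S. p - length w) \<le> (N + p) choose Suc N" .
  \<comment> \<open>Subtraction is truncated, so words longer than \<open>p\<close> give an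
    inequality here.\<close>
  moreover have "p * card S \<le> (\<Sum>w\<in>S. length w + (p - length w))"
    using sum_mono[of S "\<lambda>_. p" "\<lambda>w. length w + (p - length w)"] by (simp add: mult.commute)
  ultimately show ?thesis by (simp add: sum.distrib)
qed

text \<open>By absorption \<open>(N + p) choose Suc N\<close> is \<open>p / (N + 1)\<close> times
  \<open>card S\<close>. The previous bound thus becomes \<open>card S * p * N / (N + 1)\<close>,
  and the hypothesis on \<open>p\<close> says exactly that
  \<open>p * N > m * (N + 1)\<close>.\<close>

lemma sum_length_sorted_words_gt:
  assumes S: "finite S" "\<And>w. w \<in> S \<Longrightarrow> sorted w \<and> set w \<subseteq> {..<N}"
    and card: "card S = (N + p) choose N" and N: "N \<ge> 1"
    and p: "real p > real m * (1 + 1 / real N)"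
  shows "(\<Sum>w\<in>S. length w) > m * card S"
proof -
  have absorb: "Suc N * ((N + p) choose Suc N) = p * ((N + p) choose N)"
    using binomial_absorb_comp[of "N + p" N] binomial_absorption[of N "N + p"]
    by (simp only: add_diff_cancel_left')
  have "p * card S * Suc N \<le> ((\<Sum>w\<in>S. length w) + ((N + p) choose Suc N)) * Suc N"
    using sum_length_sorted_words_ge[OF S] mult_le_mono1 by blast
  also have "\<dots> = (\<Sum>w\<in>S. length w) * Suc N + p * card S"
    using absorb card by (simp add: algebra_simps)
  finally have "p * card S * N \<le> (\<Sum>w\<in>S. length w) * Suc N" by simp
  moreover have "p * N > m * Suc N"
  proof -
    have "real m * (real N + 1) < real p * real N"
      using p N by (simp add: field_simps)
    then have "real (m * Suc N) < real (p * N)" by (simp add: algebra_simps)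
    then show ?thesis by linarith
  qed
  moreover have "card S > 0" by (simp add: card)
  ultimately have "m * Suc N * card S < (\<Sum>w\<in>S. length w) * Suc N"
    by (metis less_le_trans mult.assoc mult.commute mult_less_mono1)
  then have "Suc N * (m * card S) < Suc N * (\<Sum>w\<in>S. length w)" by (simp only: ac_simps)
  then show ?thesis by (simp only: mult_less_cancel1)
qed


section \<open>Alternating sums\<close>

text \<open>Composition with the transposition matches even with odd permutations, and matched terms
  cancel. As nothing is divided by 2, the argument covers characteristic 2.\<close>

lemma (in vector_space) alternating_sum_eq_0:
  assumes "finite I" "i \<in> I" "j \<in> I" "i \<noteq> j"
    and sym: "\<And>a. F (a \<circ> Transposition.transpose i j) = F a"
  shows "(\<Sum>\<sigma> | \<sigma> permutes I. scale (of_int (sign \<sigma>)) (F (a \<circ> \<sigma>))) = 0"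
proof -
  let ?\<tau> = "Transposition.transpose i j"
  let ?P = "{\<sigma>. \<sigma> permutes I}"
  let ?E = "{\<sigma>. \<sigma> permutes I \<and> evenperm \<sigma>}" and ?O = "{\<sigma>. \<sigma> permutes I \<and> \<not> evenperm \<sigma>}"
  have \<tau>: "?\<tau> permutes I" using assms by (simp add: permutes_swap_id)
  have fin: "finite ?P" using assms(1) by (rule finite_permutations)
  have even: "evenperm (\<sigma> \<circ> ?\<tau>) \<longleftrightarrow> \<not> evenperm \<sigma>" if "\<sigma> permutes I" for \<sigma>
    using that assms(1,4) \<tau>
    by (subst evenperm_comp) (auto simp: evenperm_swap permutation_permutes)
  have bij: "bij_betw (\<lambda>\<sigma>. \<sigma> \<circ> ?\<tau>) ?E ?O"
    by (rule bij_betw_byWitness[where f' = "\<lambda>\<sigma>. \<sigma> \<circ> ?\<tau>"])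
      (auto simp: comp_assoc even \<tau> permutes_compose)
  have "(\<Sum>\<sigma>\<in>?O. F (a \<circ> \<sigma>)) = (\<Sum>\<sigma>\<in>?E. F (a \<circ> (\<sigma> \<circ> ?\<tau>)))"
    using sum.reindex_bij_betw[OF bij, of "\<lambda>\<sigma>. F (a \<circ> \<sigma>)"] by simp
  also have "\<dots> = (\<Sum>\<sigma>\<in>?E. F (a \<circ> \<sigma>))"
    by (simp add: sym flip: comp_assoc)
  finally have eq: "(\<Sum>\<sigma>\<in>?O. F (a \<circ> \<sigma>)) = (\<Sum>\<sigma>\<in>?E. F (a \<circ> \<sigma>))" .
  have "(\<Sum>\<sigma>\<in>?P. scale (of_int (sign \<sigma>)) (F (a \<circ> \<sigma>))) =
      (\<Sum>\<sigma>\<in>?E. scale (of_int (sign \<sigma>)) (F (a \<circ> \<sigma>))) +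
      (\<Sum>\<sigma>\<in>?O. scale (of_int (sign \<sigma>)) (F (a \<circ> \<sigma>)))"
    by (subst sum.union_disjoint[symmetric]) (use fin in \<open>auto intro!: sum.cong\<close>)
  also have "\<dots> = (\<Sum>\<sigma>\<in>?E. F (a \<circ> \<sigma>)) + (\<Sum>\<sigma>\<in>?O. - F (a \<circ> \<sigma>))"
    by (intro arg_cong2[where f = plus] sum.cong) (auto simp: sign_def)
  also have "\<dots> = 0" by (simp add: sum_negf eq)
  finally show ?thesis .
qed


section \<open>Differential operators in ordered form\<close>

lemma vector_space_fun_scale:
  assumes "vector_space scale"
  shows "vector_space (fun_scale scale)"
proof -
  interpret vector_space scale by fact
  show ?thesis by unfold_locales (auto simp: fun_scale_def algebra_simps)
qed

text \<open>Asking for a spanning family lets one argument serve both a basis, which gives the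
  explicit bound, and a spanning set padded with 0, which covers the zero Lie algebra.\<close>

locale spanned_derivations = comm_algebra scale
  for scale :: "'k::field \<Rightarrow> 'a::comm_ring \<Rightarrow> 'a" +
  fixes L :: "('a \<Rightarrow> 'a) set" and e :: "nat \<Rightarrow> 'a \<Rightarrow> 'a" and N :: nat
  assumes lie: "lie_subalgebra_of_Der scale L"
    and span_e: "module.span (fun_scale scale) (e ` {..<N}) = L"
begin

sublocale fs: vector_space "fun_scale scale"
  using vector_space_axioms by (rule vector_space_fun_scale)

lemma L_derivation:
  assumes "x \<in> L"
  shows "Vector_Spaces.linear scale scale x" "x (a * b) = x a * b + a * x b"
  using assms lie by (auto simp: lie_subalgebra_of_Der_def derivations_def)

lemma L_add: "x \<in> L \<Longrightarrow> x (a + b) = x a + x b"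
  and L_scale: "x \<in> L \<Longrightarrow> x (scale c a) = scale c (x a)"
  by (drule L_derivation(1), simp add: Vector_Spaces.linear_iff)+

lemma L_zero: "x \<in> L \<Longrightarrow> x 0 = 0"
  using L_add[of x 0 0] by simp

lemma L_commutator: "x \<in> L \<Longrightarrow> y \<in> L \<Longrightarrow> commutator x y \<in> L"
  using lie by (auto simp: lie_subalgebra_of_Der_def)

lemma e_in_L: "i < N \<Longrightarrow> e i \<in> L"
  using span_e fs.span_base[of "e i" "e ` {..<N}"] by auto

definition mono :: "nat list \<Rightarrow> 'a \<Rightarrow> 'a" where
  "mono w = foldr (\<circ>) (map e w) id"

text \<open>This is the image in End(A) of the \<open>k\<close>-th filtration step. It is spanned by
  ordered monomials only, so that the count of sorted words applies.\<close>

definition ops :: "nat \<Rightarrow> ('a \<Rightarrow> 'a) set" where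
  "ops k = fs.span (mono ` sorted_words N k)"

lemma mono_in_ops: "w \<in> sorted_words N k \<Longrightarrow> mono w \<in> ops k"
  unfolding ops_def by (blast intro: fs.span_base)

lemma ops_mono: "k \<le> l \<Longrightarrow> ops k \<subseteq> ops l"
  unfolding ops_def by (rule fs.span_mono) (auto simp: sorted_words_def)

lemma comp_ops:
  assumes x: "x \<in> L" and u: "u \<in> ops k"
    and step: "\<And>w. w \<in> sorted_words N k \<Longrightarrow> x \<circ> mono w \<in> ops l"
  shows "x \<circ> u \<in> ops l"
  using u unfolding ops_def
proof (induction rule: fs.span_induct_alt)
  case base
  have "x \<circ> (0 :: 'a \<Rightarrow> 'a) = 0" using x by (auto simp: L_zero)
  then show ?case by (simp only: fs.span_zero)
next
  case (step c v u)
  have "x \<circ> (fun_scale scale c v + u) = fun_scale scale c (x \<circ> v) + (x \<circ> u)"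
    using x by (auto simp: fun_scale_def L_add L_scale)
  moreover have "x \<circ> v \<in> fs.span (mono ` sorted_words N l)"
    using step(1) assms(3) by (auto simp: ops_def)
  ultimately show ?case using step(2) by (simp only: fs.span_add fs.span_scale)
qed

lemma ops_comp_left:
  assumes x: "x \<in> L" and step: "\<And>i. i < N \<Longrightarrow> e i \<circ> u \<in> ops k"
  shows "x \<circ> u \<in> ops k"
  using x unfolding span_e[symmetric]
proof (induction rule: fs.span_induct_alt)
  case base
  have "(0 :: 'a \<Rightarrow> 'a) \<circ> u = 0" by auto
  then show ?case by (simp only: ops_def fs.span_zero)
next
  case (step c v y)
  have "(fun_scale scale c v + y) \<circ> u = fun_scale scale c (v \<circ> u) + (y \<circ> u)"
    by (auto simp: fun_scale_def)
  moreover have "v \<circ> u \<in> ops k"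
    using step(1) assms(2) by auto
  ultimately show ?case using step(2) by (simp only: ops_def fs.span_add fs.span_scale)
qed

text \<open>Inserting a letter into its place costs commutators, which are operators of smaller order. The
  two claims have to be proved together.\<close>

lemma sorted_word_insert:
  assumes "sorted w" "set w \<subseteq> {..<N}"
  shows "(\<forall>x\<in>L. x \<circ> mono w \<in> ops (Suc (length w))) \<and>
    (\<forall>i<N. (e i \<circ> mono w) - mono (insort i w) \<in> ops (length w))"
  using assms
proof (induction "length w" arbitrary: w rule: less_induct)
  case less
  have insert: "(e i \<circ> mono w) - mono (insort i w) \<in> ops (length w)" if i: "i < N" for i
  proof (cases w)
    case Nil
    then show ?thesis by (simp add: mono_def ops_def fs.span_zero)
  next
    case (Cons y v)
    show ?thesis
    proof (cases "i \<le> y")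
      case True
      then show ?thesis using Cons by (simp add: mono_def ops_def fs.span_zero)
    next
      case False
      have y: "y < N" and v: "sorted v" "set v \<subseteq> {..<N}" using less(2,3) Cons by auto
      have IH: "x \<circ> mono u \<in> ops (Suc (length u))"
        if "x \<in> L" "length u \<le> length v" "sorted u" "set u \<subseteq> {..<N}" for x u
        using less(1)[of u] that Cons by simp
      let ?r = "(e i \<circ> mono v) - mono (insort i v)"
      have "?r \<in> ops (length v)" using less(1)[of v] v i Cons by simp
      \<comment> \<open>The remainder \<open>?r\<close> is a combination of monomials no longer than
        \<open>v\<close>, so the first claim of the induction hypothesis applies to each of
        them.\<close>
      then have "e y \<circ> ?r \<in> ops (Suc (length v))"
      proof (rule comp_ops[OF e_in_L[OF y]])
        fix u assume "u \<in> sorted_words N (length v)"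
        then show "e y \<circ> mono u \<in> ops (Suc (length v))"
          using IH[OF e_in_L[OF y], of u] ops_mono[of "Suc (length u)" "Suc (length v)"]
          by (auto simp: sorted_words_def)
      qed
      moreover have "commutator (e i) (e y) \<circ> mono v \<in> ops (Suc (length v))"
        using IH[of _ v] v L_commutator e_in_L i y by blast
      \<comment> \<open>Here \<open>y < i\<close>, so \<open>insort i w\<close> keeps
        \<open>y\<close> in front. Exchanging \<open>e i\<close> and \<open>e y\<close> costs their
        commutator, an element of \<open>L\<close>, applied to the shorter monomial of
        \<open>v\<close>.\<close>
      moreover have "(e i \<circ> mono w) - mono (insort i w) =
          (e y \<circ> ?r) + (commutator (e i) (e y) \<circ> mono v)"
      proof
        fix a
        have "e y (e i (mono v a) - mono (insort i v) a) =
            e y (e i (mono v a)) - e y (mono (insort i v) a)"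
          using L_add[OF e_in_L[OF y], of "e i (mono v a) - mono (insort i v) a"
              "mono (insort i v) a"] by simp
        then show "((e i \<circ> mono w) - mono (insort i w)) a =
            ((e y \<circ> ?r) + (commutator (e i) (e y) \<circ> mono v)) a"
          using False Cons by (simp add: mono_def commutator_def)
      qed
      ultimately show ?thesis using Cons by (simp add: ops_def fs.span_add)
    qed
  qed
  \<comment> \<open>The first claim for \<open>w\<close> follows from the second: up to terms of
    smaller order, composing with \<open>e i\<close> gives the ordered monomial of
    \<open>insort i w\<close>.\<close>
  have "x \<circ> mono w \<in> ops (Suc (length w))" if x: "x \<in> L" for x
  proof (rule ops_comp_left[OF x])
    fix i assume i: "i < N"
    have "(e i \<circ> mono w) - mono (insort i w) \<in> ops (Suc (length w))"
      using insert[OF i] ops_mono[of "length w" "Suc (length w)"] by auto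
    moreover have "mono (insort i w) \<in> ops (Suc (length w))"
      using less(2,3) i
      by (intro mono_in_ops) (auto simp: sorted_words_def sorted_insort set_insort_key)
    ultimately show "e i \<circ> mono w \<in> ops (Suc (length w))"
      unfolding ops_def using fs.span_add by fastforce
  qed
  then show ?case using insert by blast
qed

lemma L_comp_ops:
  assumes "x \<in> L" "u \<in> ops k"
  shows "x \<circ> u \<in> ops (Suc k)"
proof (rule comp_ops[OF assms])
  fix w assume "w \<in> sorted_words N k"
  then show "x \<circ> mono w \<in> ops (Suc k)"
    using sorted_word_insert[of w] assms(1) ops_mono[of "Suc (length w)" "Suc k"]
    by (auto simp: sorted_words_def)
qed

text \<open>Spanning half of Poincare-Birkhoff-Witt for operators, obtained by absorbing the letters
  one at a time from the right end of the word.\<close>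

lemma word_act_in_ops: "set (letters w) \<subseteq> L \<Longrightarrow> word_act w \<in> ops (length (letters w))"
proof -
  have "foldr (\<circ>) xs id \<in> ops (length xs)" if "set xs \<subseteq> L" for xs
    using that
  proof (induction xs)
    case Nil
    have "mono [] \<in> ops 0" by (rule mono_in_ops) (simp add: sorted_words_def)
    then show ?case by (simp add: mono_def del: id_apply flip: id_def)
  next
    case (Cons x xs)
    then have "x \<circ> foldr (\<circ>) xs id \<in> ops (Suc (length xs))"
      by (intro L_comp_ops Cons.IH) simp_all
    then show ?case
      by (simp only: foldr_Cons o_apply[of "(\<circ>) x"] list.size add_Suc_right add_0_right)
  qed
  then show "set (letters w) \<subseteq> L \<Longrightarrow> ?thesis" by (simp add: word_act_def)
qed


section \<open>Multidifferential operators\<close>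

text \<open>The argument \<open>a d\<close> is kept apart because it is not alternated over. Its
  factor also starts the product, so no unit of the algebra is required.\<close>

definition mterm :: "nat \<Rightarrow> nat list \<Rightarrow> (nat \<Rightarrow> nat list) \<Rightarrow> nat list \<Rightarrow> (nat \<Rightarrow> 'a) \<Rightarrow> 'a" where
  "mterm d is ws v a = foldr (*) (map (\<lambda>i. mono (ws i) (a i)) is) (mono v (a d))"

text \<open>The linear span of the ordered terms of total order at most \<open>k\<close>, given by
  rules so that linear statements reduce to single terms by rule induction.\<close>

inductive_set mops :: "nat \<Rightarrow> nat list \<Rightarrow> nat \<Rightarrow> ((nat \<Rightarrow> 'a) \<Rightarrow> 'a) set" for d "is" k where
  zero: "(\<lambda>a. 0) \<in> mops d is k"
| mterm: "(\<And>i. i \<in> set is \<Longrightarrow> sorted (ws i) \<and> set (ws i) \<subseteq> {..<N}) \<Longrightarrow>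
    sorted v \<and> set v \<subseteq> {..<N} \<Longrightarrow> (\<Sum>i\<in>set is. length (ws i)) + length v \<le> k \<Longrightarrow>
    mterm d is ws v \<in> mops d is k"
| add: "F \<in> mops d is k \<Longrightarrow> G \<in> mops d is k \<Longrightarrow> (\<lambda>a. F a + G a) \<in> mops d is k"
| scale: "F \<in> mops d is k \<Longrightarrow> (\<lambda>a. scale c (F a)) \<in> mops d is k"

lemma mops_mono: "F \<in> mops d is k \<Longrightarrow> k \<le> l \<Longrightarrow> F \<in> mops d is l"
  by (induction rule: mops.induct) (simp_all add: mops.zero mops.mterm mops.add mops.scale)

lemma mops_sum: "(\<And>j. j \<in> J \<Longrightarrow> F j \<in> mops d is k) \<Longrightarrow> (\<lambda>a. \<Sum>j\<in>J. F j a) \<in> mops d is k"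
  by (induction J rule: infinite_finite_induct) (simp_all add: mops.zero mops.add)

lemma mops_Cons_mono:
  assumes "F \<in> mops d is k" and i: "i \<notin> set is" and w: "w \<in> sorted_words N l"
  shows "(\<lambda>a. mono w (a i) * F a) \<in> mops d (i # is) (l + k)"
  using assms(1)
proof (induction rule: mops.induct)
  case zero
  then show ?case by (simp add: mops.zero)
next
  case (mterm ws v)
  have upd: "(if j = i then w else ws j) = ws j" if "j \<in> set is" for j
    using that i by auto
  have "mterm d (i # is) (ws(i := w)) v \<in> mops d (i # is) (l + k)"
  proof (rule mops.mterm)
    have "(\<Sum>j\<in>set is. length ((ws(i := w)) j)) = (\<Sum>j\<in>set is. length (ws j))"
      by (rule sum.cong) (use i in auto)
    then show "(\<Sum>j\<in>set (i # is). length ((ws(i := w)) j)) + length v \<le> l + k"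
      using i mterm w by (simp add: sorted_words_def)
  qed (use mterm w in \<open>auto simp: sorted_words_def\<close>)
  also have "mterm d (i # is) (ws(i := w)) v = (\<lambda>a. mono w (a i) * mterm d is ws v a)"
    using i by (auto simp: mterm_def upd cong: map_cong)
  finally show ?case .
next
  case (add F G)
  then show ?case by (auto simp: distrib_left intro: mops.add)
next
  case (scale F c)
  then show ?case
    using mops.scale[OF scale(2), of c] by (simp add: scale_mult_left mult.commute)
qed

lemma mops_Cons:
  assumes F: "F \<in> mops d is k" and i: "i \<notin> set is" and u: "u \<in> ops l"
  shows "(\<lambda>a. u (a i) * F a) \<in> mops d (i # is) (l + k)"
  using u unfolding ops_def
proof (induction rule: fs.span_induct_alt)
  case base
  then show ?case by (simp add: mops.zero)
next
  case (step c v u)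
  then obtain w where "v = mono w" "w \<in> sorted_words N l" by auto
  then have "(\<lambda>a. v (a i) * F a) \<in> mops d (i # is) (l + k)"
    using mops_Cons_mono[OF F i] by simp
  then have "(\<lambda>a. scale c (v (a i) * F a) + u (a i) * F a) \<in> mops d (i # is) (l + k)"
    by (intro mops.add mops.scale step)
  then show ?case by (simp add: fun_scale_def distrib_right scale_mult_left)
qed

lemma mops_Nil:
  assumes "u \<in> ops k"
  shows "(\<lambda>a. u (a d)) \<in> mops d [] k"
  using assms unfolding ops_def
proof (induction rule: fs.span_induct_alt)
  case base
  then show ?case by (simp add: mops.zero)
next
  case (step c v u)
  then obtain w where w: "v = mono w" "w \<in> sorted_words N k" by auto
  have "mterm d [] undefined w \<in> mops d [] k"
    by (rule mops.mterm) (use w in \<open>auto simp: sorted_words_def\<close>)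
  then have "(\<lambda>a. v (a d)) \<in> mops d [] k"
    by (simp add: mterm_def[abs_def] w)
  then have "(\<lambda>a. scale c (v (a d)) + u (a d)) \<in> mops d [] k"
    by (intro mops.add mops.scale step)
  then show ?case by (simp add: fun_scale_def)
qed

text \<open>By the Leibniz rule \<open>x\<close> hits one factor at a time. This raises the total
  order by one, and \<open>L_comp_ops\<close> restores the ordered form of the factor that was
  hit.\<close>

lemma L_mterm:
  assumes x: "x \<in> L" and "distinct is"
    and "\<And>i. i \<in> set is \<Longrightarrow> sorted (ws i) \<and> set (ws i) \<subseteq> {..<N}"
    and v: "sorted v \<and> set v \<subseteq> {..<N}"
  shows "(\<lambda>a. x (mterm d is ws v a)) \<in> mops d is (Suc ((\<Sum>i\<in>set is. length (ws i)) + length v))"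
  using assms(2,3)
proof (induction "is")
  case Nil
  have "x \<circ> mono v \<in> ops (Suc (length v))"
    using x v by (intro L_comp_ops mono_in_ops) (auto simp: sorted_words_def)
  from mops_Nil[OF this, of d] show ?case by (simp add: mterm_def)
next
  case (Cons i "is")
  let ?k = "(\<Sum>i\<in>set is. length (ws i)) + length v"
  have w: "ws i \<in> sorted_words N (length (ws i))" and i: "i \<notin> set is"
    using Cons.prems by (auto simp: sorted_words_def)
  have "x \<circ> mono (ws i) \<in> ops (Suc (length (ws i)))"
    using x w by (intro L_comp_ops mono_in_ops)
  moreover have "mterm d is ws v \<in> mops d is ?k"
    by (rule mops.mterm) (use Cons.prems v in auto)
  ultimately have 1: "(\<lambda>a. (x \<circ> mono (ws i)) (a i) * mterm d is ws v a)
      \<in> mops d (i # is) (Suc (length (ws i)) + ?k)"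
    using i by (intro mops_Cons)
  have "(\<lambda>a. x (mterm d is ws v a)) \<in> mops d is (Suc ?k)"
    using Cons by simp
  then have 2: "(\<lambda>a. mono (ws i) (a i) * x (mterm d is ws v a))
      \<in> mops d (i # is) (length (ws i) + Suc ?k)"
    using i w by (intro mops_Cons_mono)
  have "(\<lambda>a. x (mterm d (i # is) ws v a)) = (\<lambda>a. (x \<circ> mono (ws i)) (a i) * mterm d is ws v a +
      mono (ws i) (a i) * x (mterm d is ws v a))"
    by (simp add: mterm_def L_derivation(2)[OF x])
  moreover have "Suc ((\<Sum>i\<in>set (i # is). length (ws i)) + length v) = Suc (length (ws i)) + ?k"
    "Suc ((\<Sum>i\<in>set (i # is). length (ws i)) + length v) = length (ws i) + Suc ?k"
    using i by auto
  ultimately show ?case using mops.add[OF 1] 2 by (simp only: add_Suc_right add_Suc)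
qed

lemma L_mops:
  assumes x: "x \<in> L" and dist: "distinct is" and "F \<in> mops d is k"
  shows "(\<lambda>a. x (F a)) \<in> mops d is (Suc k)"
  using assms(3)
proof (induction rule: mops.induct)
  case zero
  then show ?case by (simp add: L_zero[OF x] mops.zero)
next
  case (mterm ws v)
  then show ?case using L_mterm[OF x dist, of ws v d] by (auto elim: mops_mono)
next
  case (add F G)
  then show ?case by (simp add: L_add[OF x] mops.add)
next
  case (scale F c)
  then show ?case by (simp add: L_scale[OF x] mops.scale)
qed

lemma mono_mops:
  assumes "distinct is" "F \<in> mops d is k" "set w \<subseteq> {..<N}"
  shows "(\<lambda>a. mono w (F a)) \<in> mops d is (length w + k)"
  using assms(3)
proof (induction w)
  case Nil
  then show ?case using assms by (simp add: mono_def)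
next
  case (Cons i w)
  then show ?case using L_mops[OF e_in_L[of i] assms(1)] by (simp add: mono_def)
qed

lemma ops_mops:
  assumes "distinct is" "F \<in> mops d is k" "u \<in> ops l"
  shows "(\<lambda>a. u (F a)) \<in> mops d is (l + k)"
  using assms(3) unfolding ops_def
proof (induction rule: fs.span_induct_alt)
  case base
  then show ?case by (simp add: mops.zero)
next
  case (step c v u)
  then obtain w where w: "v = mono w" "w \<in> sorted_words N l" by auto
  then have "(\<lambda>a. v (F a)) \<in> mops d is (l + k)"
    using mono_mops[OF assms(1,2), of w] by (auto simp: sorted_words_def elim: mops_mono)
  then have "(\<lambda>a. scale c (v (F a)) + u (F a)) \<in> mops d is (l + k)"
    by (intro mops.add mops.scale step)
  then show ?case by (simp add: fun_scale_def)
qed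

text \<open>Each bracket raises the order by at most \<open>m\<close>: \<open>f j\<close> acts on
  the new argument with order \<nu> j, while \<open>g j\<close> is spread over the inner product
  with order \<mu> j.\<close>

lemma nested_in_mops:
  assumes fg: "\<And>j. j \<in> J \<Longrightarrow> f j \<in> ops (\<nu> j) \<and> g j \<in> ops (\<mu> j) \<and> \<nu> j + \<mu> j \<le> m"
    and "distinct is"
  shows "(\<lambda>a. foldr (\<lambda>i x. \<Sum>j\<in>J. f j (a i) * g j x) is (a d)) \<in> mops d is (m * length is)"
  using assms(2)
proof (induction "is")
  case Nil
  show ?case using mops_Nil[OF mono_in_ops[of "[]" 0], of d]
    by (simp add: mono_def sorted_words_def)
next
  case (Cons i "is")
  let ?F = "\<lambda>a. foldr (\<lambda>i x. \<Sum>j\<in>J. f j (a i) * g j x) is (a d)"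
  have "(\<lambda>a. \<Sum>j\<in>J. f j (a i) * g j (?F a)) \<in> mops d (i # is) (m * length (i # is))"
  proof (rule mops_sum)
    fix j assume j: "j \<in> J"
    have "(\<lambda>a. f j (a i) * g j (?F a)) \<in> mops d (i # is) (\<nu> j + (\<mu> j + m * length is))"
      using Cons fg[OF j] by (intro mops_Cons ops_mops) auto
    then show "(\<lambda>a. f j (a i) * g j (?F a)) \<in> mops d (i # is) (m * length (i # is))"
      by (rule mops_mono) (use fg[OF j] in simp)
  qed
  then show ?case by simp
qed


section \<open>Vanishing of alternating multidifferential operators\<close>

text \<open>The algebra need not have a unit, so products are folded onto a last factor
  \<open>z\<close>; commutativity lets the remaining factors be reordered.\<close>

lemma foldr_times_permuted:
  fixes z :: 'a
  assumes "mset xs = mset ys"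
  shows "foldr (*) xs z = foldr (*) ys z"
proof -
  have "fold (*) xs z = fold (*) ys z"
    using assms by (intro fold_multiset_equiv[THEN fun_cong]) (auto simp: fun_eq_iff ac_simps)
  moreover have "foldr (*) xs z = fold (*) xs z" for xs
    by (rule foldr_fold[THEN fun_cong]) (auto simp: fun_eq_iff ac_simps)
  ultimately show ?thesis by simp
qed

lemma mterm_transpose:
  assumes "distinct is" "i \<in> set is" "j \<in> set is" "ws i = ws j" "d \<notin> set is"
  shows "mterm d is ws v (a \<circ> Transposition.transpose i j) = mterm d is ws v a"
proof -
  let ?\<tau> = "Transposition.transpose i j"
  let ?h = "\<lambda>i. mono (ws i) (a i)"
  have "?\<tau> permutes set is" using assms by (simp add: permutes_swap_id)
  then have "mset (map ?\<tau> is) = mset is"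
    using assms(1)
    by (intro set_eq_iff_mset_eq_distinct[THEN iffD1])
      (auto simp: distinct_map permutes_image permutes_inj_on)
  then have "mset (map ?h (map ?\<tau> is)) = mset (map ?h is)" by (metis mset_map)
  \<comment> \<open>Since \<open>ws i = ws j\<close>, the words are unchanged by the transposition,
    so swapping the arguments merely permutes the factors.\<close>
  moreover have "map (\<lambda>i. mono (ws i) ((a \<circ> ?\<tau>) i)) is = map ?h (map ?\<tau> is)"
    using assms(4) by (auto simp: transpose_def)
  moreover have "(a \<circ> ?\<tau>) d = a d" using assms by (auto simp: transpose_def)
  ultimately show ?thesis
    unfolding mterm_def by (metis foldr_times_permuted)
qed

lemma alternating_mops_eq_0:
  assumes F: "F \<in> mops d is (m * length is)" and "distinct is" "d \<notin> set is"
    and N: "N \<ge> 1" and len: "length is = (N + p) choose N"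
    and p: "real p > real m * (1 + 1 / real N)"
  shows "(\<Sum>\<sigma> | \<sigma> permutes set is. scale (of_int (sign \<sigma>)) (F (a \<circ> \<sigma>))) = 0"
  using F
proof (induction rule: mops.induct)
  case zero
  then show ?case by simp
next
  case (mterm ws v)
  \<comment> \<open>Distinct words would have total length above \<open>m * length is\<close>,
    whereas their lengths together with that of \<open>v\<close> are bounded by this number.\<close>
  have "\<not> inj_on ws (set is)"
  proof
    assume inj: "inj_on ws (set is)"
    then have card: "card (ws ` set is) = length is"
      using assms(2) by (simp add: card_image distinct_card)
    have "m * card (ws ` set is) < (\<Sum>w\<in>ws ` set is. length w)"
      by (rule sum_length_sorted_words_gt[OF _ _ _ N p]) (use mterm card len in auto)
    also have "\<dots> = (\<Sum>i\<in>set is. length (ws i))" by (simp add: sum.reindex[OF inj])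
    finally show False using mterm card by simp
  qed
  then obtain i j where "i \<in> set is" "j \<in> set is" "i \<noteq> j" "ws i = ws j"
    by (auto simp: inj_on_def)
  then show ?case
    using assms(2,3) by (intro alternating_sum_eq_0[of _ i j] mterm_transpose) auto
next
  case (add F G)
  then show ?case by (simp add: scale_right_distrib sum.distrib)
next
  case (scale F c)
  have "(\<Sum>\<sigma> | \<sigma> permutes set is. scale (of_int (sign \<sigma>)) (scale c (F (a \<circ> \<sigma>)))) =
      scale c (\<Sum>\<sigma> | \<sigma> permutes set is. scale (of_int (sign \<sigma>)) (F (a \<circ> \<sigma>)))"
    by (simp add: scale_sum_right mult.commute)
  then show ?case by (simp only: scale scale_zero_right)
qed

section \<open>Standard identities for derived operations\<close>

lemma standard_left_eq_0:
  assumes fg: "\<And>j. j \<in> J \<Longrightarrow> f j \<in> ops (\<nu> j) \<and> g j \<in> ops (\<mu> j) \<and> \<nu> j + \<mu> j \<le> m"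
    and N: "N \<ge> 1" and p: "real p > real m * (1 + 1 / real N)"
  shows "standard_left scale (\<lambda>x y. \<Sum>j\<in>J. f j x * g j y) (1 + ((N + p) choose N)) a = 0"
proof -
  let ?d = "1 + ((N + p) choose N)"
  let ?F = "\<lambda>a. foldr (\<lambda>i x. \<Sum>j\<in>J. f j (a i) * g j x) [1..<?d] (a ?d)"
  have F: "?F \<in> mops ?d [1..<?d] (m * length [1..<?d])"
    by (rule nested_in_mops[OF fg]) simp_all
  have "(\<Sum>\<sigma> | \<sigma> permutes set [1..<?d]. scale (of_int (sign \<sigma>)) (?F (a \<circ> \<sigma>))) = 0"
    by (rule alternating_mops_eq_0[OF F _ _ N _ p]) (simp_all add: Suc_le_eq)
  moreover have "standard_left scale (\<lambda>x y. \<Sum>j\<in>J. f j x * g j y) ?d a =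
      (\<Sum>\<sigma> | \<sigma> permutes set [1..<?d]. scale (of_int (sign \<sigma>)) (?F (a \<circ> \<sigma>)))"
    unfolding standard_left_def set_upt comp_apply
  proof (intro sum.cong refl)
    \<comment> \<open>The permutations fix \<open>d\<close>, so the whole family \<open>a\<close>
      may be composed with \<sigma>, the last slot included; this is the form treated by
      \<open>alternating_mops_eq_0\<close>.\<close>
    fix \<sigma> assume "\<sigma> \<in> {\<sigma>. \<sigma> permutes {1..<?d}}"
    then have "\<sigma> ?d = ?d" by (intro permutes_not_in[of \<sigma> "{1..<?d}"]) simp_all
    then show "scale (of_int (sign \<sigma>))
          (foldr (\<lambda>i x. \<Sum>j\<in>J. f j (a (\<sigma> i)) * g j x) [1..<?d] (a ?d)) =
        scale (of_int (sign \<sigma>))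
          (foldr (\<lambda>i x. \<Sum>j\<in>J. f j (a (\<sigma> i)) * g j x) [1..<?d] (a (\<sigma> ?d)))"
      by (simp only:)
  qed
  ultimately show ?thesis by (rule trans[rotated])
qed

text \<open>The representative chosen by \<open>env_act\<close> may contain words longer than
  \<open>k\<close>. By \<open>env_act_class\<close> it can be replaced by one whose words have
  length at most \<open>k\<close>.\<close>

lemma env_act_in_ops:
  assumes "u \<in> env_filtration (fun_scale scale) commutator L k"
  shows "env_act scale u \<in> ops k"
proof -
  obtain P where P: "u = env_class (fun_scale scale) commutator L P" "P \<in> free_algebra L"
    "\<forall>w\<in>Poly_Mapping.keys P. length (letters w) \<le> k"
    using assms by (auto simp: env_filtration_def)
  have "env_act scale u = free_act scale P"
    unfolding P(1) by (rule env_act_class[OF comm_algebra_axioms lie])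
  also have "\<dots> = (\<Sum>w\<in>Poly_Mapping.keys P.
      fun_scale scale (Poly_Mapping.lookup P w) (word_act w))"
  proof
    fix a
    have "(\<Sum>w\<in>W. h w) a = (\<Sum>w\<in>W. h w a)" for W and h :: "('a \<Rightarrow> 'a) fword \<Rightarrow> 'a \<Rightarrow> 'a"
      by (induction W rule: infinite_finite_induct) auto
    then show "free_act scale P a = (\<Sum>w\<in>Poly_Mapping.keys P.
        fun_scale scale (Poly_Mapping.lookup P w) (word_act w)) a"
      by (simp add: free_act_def fun_scale_def)
  qed
  also have "\<dots> \<in> ops k"
    unfolding ops_def
  proof (intro fs.span_sum fs.span_scale)
    fix w assume "w \<in> Poly_Mapping.keys P"
    then show "word_act w \<in> fs.span (mono ` sorted_words N k)"
      using P(2,3) word_act_in_ops[of w] ops_mono[of "length (letters w)" k]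
      by (auto simp: free_algebra_def ops_def)
  qed
  finally show ?thesis .
qed

lemma standard_identity_derived_operation:
  assumes fg: "\<forall>j\<in>{1..s}. f j \<in> env_filtration (fun_scale scale) commutator L (\<nu> j) \<and>
      g j \<in> env_filtration (fun_scale scale) commutator L (\<mu> j)"
    and N: "N \<ge> 1" and p: "real p > real (lie_order s \<nu> \<mu>) * (1 + 1 / real N)"
  shows "standard_identity scale (derived_operation scale s f g) (1 + ((N + p) choose N))"
proof -
  let ?f = "\<lambda>j. env_act scale (f j)" and ?g = "\<lambda>j. env_act scale (g j)"
  have order: "\<nu> j + \<mu> j \<le> lie_order s \<nu> \<mu>" if "j \<in> {1..s}" for j
    unfolding lie_order_def using that by (intro Max_ge) auto
  have left: "derived_operation scale s f g = (\<lambda>x y. \<Sum>j=1..s. ?f j x * ?g j y)"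
    by (simp add: fun_eq_iff derived_operation_def)
  \<comment> \<open>As the algebra is commutative, exchanging the families \<open>f\<close> and
    \<open>g\<close> gives the opposite operation, and right nesting becomes left nesting.\<close>
  have right: "standard_right scale (derived_operation scale s f g) d a =
      standard_left scale (\<lambda>x y. \<Sum>j=1..s. ?g j x * ?f j y) d a" for d a
    by (simp add: standard_left_def standard_right_def derived_operation_def mult.commute)
  show ?thesis
    unfolding standard_identity_def right
    using standard_left_eq_0[of "{1..s}" ?f \<nu> ?g \<mu>, OF _ N p]
      standard_left_eq_0[of "{1..s}" ?g \<mu> ?f \<nu>, OF _ N p]
    using fg order env_act_in_ops by (simp add: left add.commute)
qed

end


section \<open>Generated Lie algebras of derivations\<close>

text \<open>This makes the intersection defining \<open>lie_generated\<close> range over a nonempty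
  family, so that generated algebras consist of derivations.\<close>

lemma lie_subalgebra_derivations:
  assumes "comm_algebra scale"
  shows "lie_subalgebra_of_Der scale (derivations scale)"
proof -
  interpret comm_algebra scale by fact
  interpret fs: vector_space "fun_scale scale"
    using vector_space_axioms by (rule vector_space_fun_scale)
  have mult_right: "scale c (x * y) = x * scale c y" for c x y
    using scale_mult_left[of c y x] by (simp add: mult.commute)
  have der: "D \<in> derivations scale \<longleftrightarrow> (\<forall>a b. D (a + b) = D a + D b) \<and>
      (\<forall>c a. D (scale c a) = scale c (D a)) \<and> (\<forall>a b. D (a * b) = D a * b + a * D b)" for D
    using vector_space_axioms
    by (auto simp: derivations_def Vector_Spaces.linear_iff)
  have zero: "D 0 = 0" "D (a - b) = D a - D b" if "D \<in> derivations scale" for D a b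
  proof -
    interpret D: Vector_Spaces.linear scale scale D
      using that by (simp add: derivations_def)
    show "D 0 = 0" "D (a - b) = D a - D b" by (simp_all add: D.zero D.diff)
  qed
  have "commutator D E \<in> derivations scale"
    if "D \<in> derivations scale" "E \<in> derivations scale" for D E
    using that zero[OF that(1)] zero[OF that(2)]
    by (simp add: der commutator_def algebra_simps scale_right_diff_distrib)
  moreover have "fs.subspace (derivations scale)"
    by (rule fs.subspaceI)
      (simp_all add: der fun_scale_def algebra_simps flip: scale_mult_left mult_right)
  ultimately show ?thesis by (simp add: lie_subalgebra_of_Der_def)
qed

lemma lie_subalgebra_lie_generated:
  assumes "comm_algebra scale" "S \<subseteq> derivations scale"
  shows "lie_subalgebra_of_Der scale (lie_generated scale S)" "S \<subseteq> lie_generated scale S"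
proof -
  interpret comm_algebra scale by fact
  interpret fs: vector_space "fun_scale scale"
    using vector_space_axioms by (rule vector_space_fun_scale)
  have "lie_generated scale S \<subseteq> derivations scale"
    using lie_subalgebra_derivations[OF assms(1)] assms(2)
    unfolding lie_generated_def by (rule hull_minimal[rotated])
  then show "lie_subalgebra_of_Der scale (lie_generated scale S)"
    unfolding lie_generated_def hull_def lie_subalgebra_of_Der_def fs.subspace_def by auto
  show "S \<subseteq> lie_generated scale S"
    unfolding lie_generated_def by (rule hull_subset)
qed

text \<open>A representative has finitely many words, so their lengths are bounded. This supplies
  orders for the existence claim, where none are given.\<close>

lemma env_combinations_filtration:
  assumes "u \<in> env_combinations sc br L X" "X \<subseteq> L"
  shows "\<exists>k. u \<in> env_filtration sc br L k"
proof -
  obtain P where P: "u = env_class sc br L P" "P \<in> free_algebra X"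
    using assms(1) by (auto simp: env_combinations_def)
  have "length (letters w) \<le> Max ((\<lambda>w. length (letters w)) ` Poly_Mapping.keys P)"
    if "w \<in> Poly_Mapping.keys P" for w
    using that by (intro Max_ge) auto
  moreover have "P \<in> free_algebra L" using P(2) assms(2) by (auto simp: free_algebra_def)
  ultimately show ?thesis unfolding env_filtration_def P(1) by blast
qed

lemma spanned_derivations_enumerate:
  assumes "comm_algebra scale" "lie_subalgebra_of_Der scale L"
    and "finite B" "module.span (fun_scale scale) B = L"
  obtains e where "spanned_derivations scale L e (card B)"
proof -
  obtain e where "bij_betw e {..<card B} B"
    using ex_bij_betw_nat_finite[OF assms(3)] by (auto simp: atLeast0LessThan)
  then have "e ` {..<card B} = B" by (simp add: bij_betw_def)
  then have "spanned_derivations scale L e (card B)"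
    using assms by (simp add: spanned_derivations_def spanned_derivations_axioms_def)
  then show thesis by (rule that)
qed

theorem theorem3:
  fixes scale :: "'k::field \<Rightarrow> 'a::comm_ring \<Rightarrow> 'a"
    and n :: nat and D :: "nat \<Rightarrow> 'a \<Rightarrow> 'a"
    and \<gg> :: "('a \<Rightarrow> 'a) set"
    and s :: nat and f g :: "nat \<Rightarrow> (('a \<Rightarrow> 'a) fword \<Rightarrow>\<^sub>0 'k) set"
  assumes "comm_algebra scale"
    and "\<And>i. i \<in> {1..n} \<Longrightarrow> D i \<in> derivations scale"
    and "\<gg> = lie_generated scale (D ` {1..n})"
    and "finite_dimensional (fun_scale scale) \<gg>"
    and "\<And>j. j \<in> {1..s} \<Longrightarrow>
           f j \<in> env_combinations (fun_scale scale) commutator \<gg> (D ` {1..n})"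
    and "\<And>j. j \<in> {1..s} \<Longrightarrow>
           g j \<in> env_combinations (fun_scale scale) commutator \<gg> (D ` {1..n})"
  shows "(\<exists>d>0. standard_identity scale (derived_operation scale s f g) d) \<and>
    (\<forall>N m p :: nat. \<forall>\<nu> \<mu> :: nat \<Rightarrow> nat.
      N = vector_space.dim (fun_scale scale) \<gg> \<longrightarrow> N \<ge> 1 \<longrightarrow>
      (\<forall>j\<in>{1..s}. f j \<in> env_filtration (fun_scale scale) commutator \<gg> (\<nu> j) \<and>
                   g j \<in> env_filtration (fun_scale scale) commutator \<gg> (\<mu> j)) \<longrightarrow>
      m = lie_order s \<nu> \<mu> \<longrightarrow>
      real p > real m * (1 + 1 / real N) \<longrightarrow>
      standard_identity scale (derived_operation scale s f g) (1 + ((N + p) choose N)))"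
proof -
  interpret comm_algebra scale by fact
  interpret fs: vector_space "fun_scale scale"
    using vector_space_axioms by (rule vector_space_fun_scale)
  have "D ` {1..n} \<subseteq> derivations scale" using assms(2) by auto
  note lie = lie_subalgebra_lie_generated(1)[OF assms(1) this, folded assms(3)]
    and gen_subset = lie_subalgebra_lie_generated(2)[OF assms(1) this, folded assms(3)]
  obtain B where B: "finite B" "fs.span B = \<gg>"
    using assms(4) by (auto simp: finite_dimensional_def)
  have "\<exists>d>0. standard_identity scale (derived_operation scale s f g) d"
  proof -
    \<comment> \<open>Adding 0 to the spanning set makes it nonempty, which covers the case \<open>\<gg> = 0\<close>.\<close>
    have "fs.span (insert 0 B) = \<gg>" using B(2) by simp
    then obtain e where "spanned_derivations scale \<gg> e (card (insert 0 B))"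
      using spanned_derivations_enumerate[OF assms(1) lie, of "insert 0 B"] B(1) by blast
    then interpret spanned_derivations scale \<gg> e "card (insert 0 B)" .
    have "\<forall>j\<in>{1..s}. \<exists>k. f j \<in> env_filtration (fun_scale scale) commutator \<gg> k"
      "\<forall>j\<in>{1..s}. \<exists>k. g j \<in> env_filtration (fun_scale scale) commutator \<gg> k"
      using env_combinations_filtration[OF _ gen_subset] assms(5,6) by blast+
    then obtain \<nu> \<mu> where fg:
      "\<forall>j\<in>{1..s}. f j \<in> env_filtration (fun_scale scale) commutator \<gg> (\<nu> j) \<and>
        g j \<in> env_filtration (fun_scale scale) commutator \<gg> (\<mu> j)"
      by metis
    let ?m = "lie_order s \<nu> \<mu>"
    have N: "card (insert 0 B) \<ge> 1" using B(1) by (simp add: Suc_le_eq card_gt_0_iff)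
    then have "real ?m * (1 + 1 / real (card (insert 0 B))) \<le> real ?m * 2"
      by (intro mult_left_mono) (auto simp: field_simps)
    \<comment> \<open>The spanning family is nonempty, hence \<open>1 + 1/N\<close> is at most 2 and
      \<open>p = 2 * ?m + 1\<close> is large enough.\<close>
    then have "real (2 * ?m + 1) > real ?m * (1 + 1 / real (card (insert 0 B)))" by simp
    from standard_identity_derived_operation[OF fg N this] show ?thesis
      by (intro exI[of _ "1 + _"] conjI) simp_all
  qed
  moreover have "standard_identity scale (derived_operation scale s f g) (1 + ((N + p) choose N))"
    if N: "N = fs.dim \<gg>" "N \<ge> 1" and fg:
      "\<forall>j\<in>{1..s}. f j \<in> env_filtration (fun_scale scale) commutator \<gg> (\<nu> j) \<and>
        g j \<in> env_filtration (fun_scale scale) commutator \<gg> (\<mu> j)"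
      and p: "real p > real (lie_order s \<nu> \<mu>) * (1 + 1 / real N)" for N p \<nu> \<mu>
  proof -
    obtain C where C: "C \<subseteq> \<gg>" "fs.independent C" "\<gg> \<subseteq> fs.span C" "card C = N"
      using fs.basis_exists[of \<gg>] N(1) by metis
    \<comment> \<open>Infinite sets have \<open>card\<close> 0, so \<open>N\<close> \<ge> 1 forces
      the basis \<open>C\<close> to be finite.\<close>
    have "finite C" using C(4) N(2) by (intro card_ge_0_finite) simp
    moreover have "fs.span C = \<gg>"
      using C(1,3) B(2) fs.span_minimal[OF C(1)] fs.subspace_span[of B] by blast
    ultimately obtain e where "spanned_derivations scale \<gg> e N"
      using spanned_derivations_enumerate[OF assms(1) lie, of C] C(4) by blast
    then interpret spanned_derivations scale \<gg> e N .
    show ?thesis using standard_identity_derived_operation[OF fg N(2) p] .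
  qed
  ultimately show ?thesis by simp
qed

end
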